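(* Let $E$ be a Banach lattice with order continuous norm and let $\mathcal{T} = (T_t)_{t \in J}$ be a bounded positive semigroup on $E$, where either $J = \mathbb{N}$ or $J =(0,\infty)$. Assume that there exist a constant $M > 0$, a quasi-interior point $f_0$ of $E_+$ and a strictly positive functional $\psi \in E'_+$ such that $T_t f_0 \le M f_0$ and $T_t' \psi \le M \psi$ for all $t \in J$. Then the following assertions are equivalent: (i) $\mathcal{T}$ is strongly convergent (as $t\to\infty$) and the limit operator $P$ is a rank-$1$ projection which fulfils $P'\psi \ge \varepsilon \psi$ for some $\varepsilon > 0$. (ii) There exists a non-zero lower bound $h$ for $\mathcal{T}$ with respect to $\psi$.
   Context: All spaces are real. $\mathbb{N} = \{1,2,\dots\}$. $E_+$ is the positive cone of $E$, $E'$ the dual Banach lattice, and $T'$ the adjoint of $T$. A point $f_0 \in E_+$ is a quasi-interior point of $E_+$ if the principal ideal $E_{f_0} = \bigcup_{c>0}\{g \in E : |g|\le c f_0\}$ is dense in $E$. A functional $\psi \in E'$ is strictly positive if $\langle\psi,f\rangle>0$ for all $f\ge 0$, $f\neq 0$. A semigroup on $E$ is a family $(T_t)_{t \in J}$ of bounded linear operators on $E$ with $T_{t+s} = T_tT_s$ for all $s,t \in J$; no continuity in $t$ is assumed. It is bounded if $\sup_{t\in J}\|T_t\|<\infty$, and positive if $T_tE_+\subseteq E_+$ for all $t \in J$. Strongly convergent means convergent in the strong operator topology to a bounded linear operator. For $\psi \in E'_+$, a vector $h\in E_+$ is a lower bound for $\mathcal{T}$ with respect to $\psi$ if $\langle\psi,(T_tf-h)^-\rangle\to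 0$ as $t\to\infty$ for every $f\in E_+$ with $\langle\psi,f\rangle=1$; here $g^- = (-g)\vee 0$. *)

theory Defs
  imports "HOL-Analysis.Analysis" "HOL-Library.Lattice_Algebras"
begin

class banach_lattice = banach + lattice_ab_group_add_abs + ordered_real_vector +
  assumes norm_abs_mono: "\<bar>x\<bar> \<le> \<bar>y\<bar> \<Longrightarrow> norm x \<le> norm y"

instance real :: banach_lattice
  by standard simp

text \<open>Norms of downward directed sets with infimum \<open>0\<close> have infimum \<open>0\<close>. Since the norm is monotone
  on the positive cone, this says that every decreasing net with infimum \<open>0\<close> tends to \<open>0\<close> in norm.\<close>

definition order_continuous_norm :: "'a::banach_lattice itself \<Rightarrow> bool" where
  "order_continuous_norm _ \<longleftrightarrow>
    (\<forall>D :: 'a set. D \<noteq> {} \<longrightarrow>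
       (\<forall>x\<in>D. \<forall>y\<in>D. \<exists>z\<in>D. z \<le> x \<and> z \<le> y) \<longrightarrow>
       (\<forall>x\<in>D. 0 \<le> x) \<longrightarrow> (\<forall>b. (\<forall>x\<in>D. b \<le> x) \<longrightarrow> b \<le> 0) \<longrightarrow>
       (INF x\<in>D. norm x) = 0)"

definition principal_ideal :: "'a::banach_lattice \<Rightarrow> 'a set" where
  "principal_ideal f = (\<Union>c\<in>{0<..}. {g. \<bar>g\<bar> \<le> c *\<^sub>R f})"

definition quasi_interior_point :: "'a::banach_lattice \<Rightarrow> bool" where
  "quasi_interior_point f \<longleftrightarrow> 0 \<le> f \<and> closure (principal_ideal f) = UNIV"

text \<open>The library's \<open>nprt\<close> is \<open>inf x 0\<close>, the negative of this.\<close>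

definition neg_part :: "'a::banach_lattice \<Rightarrow> 'a" where
  "neg_part g = sup (- g) 0"

text \<open>The dual space of \<open>'a\<close> is the type \<open>'a \<Rightarrow>\<^sub>L real\<close>. It has no order in the library, so the order
  of the dual Banach lattice is given explicitly.\<close>

definition dual_le :: "('a::banach_lattice \<Rightarrow>\<^sub>L real) \<Rightarrow> ('a \<Rightarrow>\<^sub>L real) \<Rightarrow> bool" where
  "dual_le \<phi> \<psi> \<longleftrightarrow> (\<forall>f\<ge>0. \<phi> f \<le> \<psi> f)"

definition strictly_positive :: "('a::banach_lattice \<Rightarrow>\<^sub>L real) \<Rightarrow> bool" where
  "strictly_positive \<psi> \<longleftrightarrow> (\<forall>f\<ge>0. f \<noteq> 0 \<longrightarrow> 0 < \<psi> f)"

definition dual_op :: "('a::banach_lattice \<Rightarrow>\<^sub>L 'a) \<Rightarrow> ('a \<Rightarrow>\<^sub>L real) \<Rightarrow> ('a \<Rightarrow>\<^sub>L real)" where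
  "dual_op T \<psi> = \<psi> o\<^sub>L T"

text \<open>An operator family over a time set \<open>J\<close> is a function on all of \<open>real\<close> whose values outside
  \<open>J\<close> are irrelevant; in discrete time \<open>J\<close> is the set of positive integers, seen as reals.\<close>

definition op_semigroup :: "real set \<Rightarrow> (real \<Rightarrow> 'a::banach_lattice \<Rightarrow>\<^sub>L 'a) \<Rightarrow> bool" where
  "op_semigroup J T \<longleftrightarrow> (\<forall>t\<in>J. \<forall>s\<in>J. T (t + s) = T t o\<^sub>L T s)"

definition bounded_family :: "real set \<Rightarrow> (real \<Rightarrow> 'a::banach_lattice \<Rightarrow>\<^sub>L 'a) \<Rightarrow> bool" where
  "bounded_family J T \<longleftrightarrow> bounded (T ` J)"

definition positive_family :: "real set \<Rightarrow> (real \<Rightarrow> 'a::banach_lattice \<Rightarrow>\<^sub>L 'a) \<Rightarrow> bool" where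
  "positive_family J T \<longleftrightarrow> (\<forall>t\<in>J. \<forall>f\<ge>0. 0 \<le> T t f)"

definition infty_in :: "real set \<Rightarrow> real filter" where
  "infty_in J = inf at_top (principal J)"

definition strongly_converges ::
  "real set \<Rightarrow> (real \<Rightarrow> 'a::banach_lattice \<Rightarrow>\<^sub>L 'a) \<Rightarrow> ('a \<Rightarrow>\<^sub>L 'a) \<Rightarrow> bool" where
  "strongly_converges J T P \<longleftrightarrow> (\<forall>f. ((\<lambda>t. T t f) \<longlongrightarrow> P f) (infty_in J))"

definition rank1_projection :: "('a::banach_lattice \<Rightarrow>\<^sub>L 'a) \<Rightarrow> bool" where
  "rank1_projection P \<longleftrightarrow> P o\<^sub>L P = P \<and> dim (range (blinfun_apply P)) = 1"

definition lower_bound ::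
  "real set \<Rightarrow> (real \<Rightarrow> 'a::banach_lattice \<Rightarrow>\<^sub>L 'a) \<Rightarrow> ('a \<Rightarrow>\<^sub>L real) \<Rightarrow> 'a \<Rightarrow> bool" where
  "lower_bound J T \<psi> h \<longleftrightarrow> 0 \<le> h \<and>
    (\<forall>f\<ge>0. \<psi> f = 1 \<longrightarrow> ((\<lambda>t. \<psi> (neg_part (T t f - h))) \<longlongrightarrow> 0) (infty_in J))"

end

theory Submission
  imports Defs
begin

text \<open>
  The functional \<open>\<psi>\<close> gives the weaker norm \<open>\<psi> \<bar>x\<bar>\<close>, in which the semigroup is bounded by \<open>M\<close>.
  The interesting direction starts from a non-zero lower bound and has three ingredients.

  The first is a fixed point that is itself a non-zero lower bound. All lower bounds lie below one
  multiple of \<open>f\<^sub>0\<close>, because the orbit of \<open>f\<^sub>0\<close> does, and they are closed under suprema and under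
  the operators \<open>T s\<close>. Order continuity of the norm provides suprema of bounded directed sets as norm
  limits (\<open>directed_sup\<close>), so there is a greatest lower bound. Its orbit decreases, and the limit is the
  desired fixed point \<open>k\<close> (\<open>fixed_lower_bound\<close>).

  The second is convergence in the weak norm. For \<open>f \<ge> 0\<close> let \<open>c\<close> be the largest number with
  \<open>c *\<^sub>R k\<close> asymptotically below the orbit of \<open>f\<close>. If the excess of the orbit over \<open>c *\<^sub>R k\<close> had
  \<open>\<psi>\<close>-size at least \<open>\<delta>\<close> at arbitrarily late times, the lower bound \<open>k\<close>, applied to the excess at such a time, would push
  the orbit asymptotically above \<open>(c + \<delta>) *\<^sub>R k\<close> (\<open>asymp_ge_add_excess\<close>). So the excess tends to \<open>0\<close>
  and \<open>T t f\<close> tends to \<open>c *\<^sub>R k\<close> in the weak norm.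

  The third is the passage to norm convergence. If \<open>f \<ge> 0\<close> lies below a multiple of \<open>f\<^sub>0\<close>, its orbit stays in
  an order interval, and there weak smallness implies smallness in norm
  (\<open>order_interval_norm_small\<close>). Such \<open>f\<close> span a dense subspace, and the boundedness of the semigroup
  extends the convergence to the whole space. Every limit is a multiple of \<open>k\<close>, so the limit operator
  is a projection of rank one.

  Conversely, if the limit is such a projection \<open>P\<close>, the images \<open>P f\<close> of the positive vectors with
  \<open>\<psi> f = 1\<close> are multiples of one positive vector \<open>p\<close> with coefficients bounded away from \<open>0\<close>, and
  scaling \<open>p\<close> by this bound gives a lower bound (\<open>lower_bound_of_rank1_limit\<close>).
\<close>

section \<open>Negative parts and limits in a Banach lattice\<close>

lemma neg_part_nonneg: "0 \<le> neg_part g"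
  by (simp add: neg_part_def)

lemma minus_le_neg_part: "- g \<le> neg_part g"
  by (simp add: neg_part_def)

lemma neg_part_least: "- g \<le> u \<Longrightarrow> 0 \<le> u \<Longrightarrow> neg_part g \<le> u"
  by (simp add: neg_part_def)

lemma neg_part_eq_0_iff: "neg_part g = 0 \<longleftrightarrow> 0 \<le> g"
proof
  assume "neg_part g = 0"
  then show "0 \<le> g" using minus_le_neg_part[of g] by simp
next
  assume "0 \<le> g"
  then show "neg_part g = 0"
    by (simp add: neg_part_def sup_absorb2)
qed

lemma neg_part_antimono: "f \<le> g \<Longrightarrow> neg_part g \<le> neg_part f"
  unfolding neg_part_def by (rule sup_mono) simp_all

lemma neg_part_add_le: "neg_part (f + g) \<le> neg_part f + neg_part g"
proof (rule neg_part_least)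
  show "- (f + g) \<le> neg_part f + neg_part g"
    using add_mono[OF minus_le_neg_part[of f] minus_le_neg_part[of g]] by (simp add: algebra_simps)
qed (simp add: add_nonneg_nonneg neg_part_nonneg)

lemma neg_part_diff_sup_le: "neg_part (g - sup x y) \<le> neg_part (g - x) + neg_part (g - y)"
proof (rule neg_part_least)
  have "x - g \<le> neg_part (g - x)" "y - g \<le> neg_part (g - y)"
    using minus_le_neg_part[of "g - x"] minus_le_neg_part[of "g - y"] by simp_all
  then have "x - g \<le> neg_part (g - x) + neg_part (g - y)"
    and "y - g \<le> neg_part (g - x) + neg_part (g - y)"
    by (simp_all add: add_increasing add_increasing2 neg_part_nonneg)
  then have "sup x y \<le> neg_part (g - x) + neg_part (g - y) + g"
    by (simp add: diff_le_eq)
  then show "- (g - sup x y) \<le> neg_part (g - x) + neg_part (g - y)"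
    by (simp add: diff_le_eq)
qed (simp add: add_nonneg_nonneg neg_part_nonneg)

lemma neg_part_scaleR:
  assumes "0 \<le> c" shows "neg_part (c *\<^sub>R g) = c *\<^sub>R neg_part g"
proof (cases "c = 0")
  case True
  then show ?thesis by (simp add: neg_part_def)
next
  case False
  have le: "neg_part (c *\<^sub>R g) \<le> c *\<^sub>R neg_part g" if "0 \<le> c" for c and g :: 'a
    using scaleR_left_mono[OF minus_le_neg_part[of g] that]
    by (intro neg_part_least) (simp_all add: that neg_part_nonneg scaleR_nonneg_nonneg)
  have "c *\<^sub>R neg_part (inverse c *\<^sub>R (c *\<^sub>R g)) \<le> c *\<^sub>R (inverse c *\<^sub>R neg_part (c *\<^sub>R g))"
    by (intro scaleR_left_mono le) (simp_all add: assms)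
  then show ?thesis
    using False le[OF assms, of g] by (simp add: order_antisym)
qed

lemma pos_part_minus_neg_part: "neg_part (- g) - neg_part g = g"
proof -
  have "neg_part (- g) = pprt g" "neg_part g = - nprt g"
    by (simp_all add: neg_part_def pprt_def nprt_def neg_inf_eq_sup)
  then show ?thesis
    by (simp flip: prts)
qed

lemma abs_eq_parts: "\<bar>g\<bar> = neg_part (- g) + neg_part g"
proof -
  have "neg_part (- g) = pprt g" "neg_part g = - nprt g"
    by (simp_all add: neg_part_def pprt_def nprt_def neg_inf_eq_sup)
  then show ?thesis
    by (simp add: abs_prts)
qed

lemma neg_part_le_abs: "neg_part g \<le> \<bar>g\<bar>"
  by (simp add: abs_ge_minus_self neg_part_least)

lemma norm_mono_nonneg:
  fixes x y :: "'a::banach_lattice"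
  assumes "0 \<le> x" "x \<le> y"
  shows "norm x \<le> norm y"
  using assms by (intro norm_abs_mono) simp

lemma norm_abs_eq [simp]:
  fixes x :: "'a::banach_lattice"
  shows "norm \<bar>x\<bar> = norm x"
  by (simp add: norm_abs_mono order_antisym)

lemma norm_neg_part_le: "norm (neg_part g) \<le> norm g"
  using norm_mono_nonneg[OF neg_part_nonneg neg_part_le_abs, of g] by simp

text \<open>The negative part of a limit of positive vectors is dominated in norm by the approximation error,
  so the positive cone is closed.\<close>

lemma nonneg_tendsto:
  fixes x :: "'b \<Rightarrow> 'a::banach_lattice"
  assumes "(x \<longlongrightarrow> l) F" "eventually (\<lambda>t. 0 \<le> x t) F" "F \<noteq> bot"
  shows "0 \<le> l"
proof -
  have "((\<lambda>t. norm (l - x t)) \<longlongrightarrow> 0) F"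
    using tendsto_norm[OF tendsto_diff[OF tendsto_const[of l] assms(1)]] by simp
  moreover have "eventually (\<lambda>t. norm (neg_part l) \<le> norm (l - x t)) F"
    using assms(2)
  proof eventually_elim
    case (elim t)
    then have "neg_part l \<le> neg_part (l - x t)"
      by (intro neg_part_antimono) simp
    then show ?case
      using order_trans[OF norm_mono_nonneg[OF neg_part_nonneg] norm_neg_part_le] by blast
  qed
  ultimately have "norm (neg_part l) \<le> 0"
    by (rule tendsto_lowerbound) (use assms(3) in simp)
  then show ?thesis
    by (simp add: neg_part_eq_0_iff)
qed

lemma tendsto_le_lattice:
  fixes x y :: "'b \<Rightarrow> 'a::banach_lattice"
  assumes "(x \<longlongrightarrow> a) F" "(y \<longlongrightarrow> b) F" "eventually (\<lambda>t. x t \<le> y t) F" "F \<noteq> bot"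
  shows "a \<le> b"
proof -
  have "0 \<le> b - a"
    by (rule nonneg_tendsto[OF tendsto_diff[OF assms(2,1)]]) (use assms(3,4) in simp_all)
  then show ?thesis by simp
qed

text \<open>Dividing by \<open>n\<close> and using that the cone is closed gives \<open>b \<le> 0\<close>.\<close>

lemma lattice_archimedean:
  fixes b u :: "'a::banach_lattice"
  assumes "\<And>n::nat. of_nat n *\<^sub>R b \<le> u"
  shows "b \<le> 0"
proof (rule tendsto_le_lattice)
  show "(\<lambda>n. inverse (real (Suc n)) *\<^sub>R u) \<longlonglongrightarrow> 0"
    using tendsto_scaleR[OF LIMSEQ_inverse_real_of_nat tendsto_const[of u]] by simp
  have "b \<le> inverse (real (Suc n)) *\<^sub>R u" for n
    using scaleR_left_mono[OF assms[of "Suc n"], of "inverse (real (Suc n))"]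
    by (simp del: of_nat_Suc)
  then show "\<forall>\<^sub>F n in sequentially. b \<le> inverse (real (Suc n)) *\<^sub>R u" by simp
qed (simp_all)

section \<open>Order continuity of the norm\<close>

text \<open>The gaps \<open>u - d\<close> between upper bounds \<open>u\<close> of \<open>D\<close> and elements \<open>d\<close> of \<open>D\<close> form a downward
  directed set of positive vectors. Its infimum is \<open>0\<close>, which does not presuppose a supremum of \<open>D\<close>: a lower
  bound \<open>b\<close> of the gaps can be subtracted from an upper bound of \<open>D\<close> any number of times, so all its
  multiples are bounded above. Order continuity of the norm then makes some gap small in norm.\<close>

lemma sup_gap_small:
  fixes D :: "'a::banach_lattice set"
  assumes oc: "order_continuous_norm TYPE('a)"
    and "D \<noteq> {}" and dir: "\<And>x y. x \<in> D \<Longrightarrow> y \<in> D \<Longrightarrow> \<exists>z\<in>D. x \<le> z \<and> y \<le> z"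
    and bdd: "\<And>x. x \<in> D \<Longrightarrow> x \<le> w" and "e > 0"
  obtains u d where "d \<in> D" "\<And>x. x \<in> D \<Longrightarrow> x \<le> u" "norm (u - d) < e"
proof -
  define G where "G = {u - d |u d. d \<in> D \<and> (\<forall>x\<in>D. x \<le> u)}"
  have ne: "G \<noteq> {}"
    using assms(2) bdd by (auto simp: G_def)
  have dirG: "\<exists>z\<in>G. z \<le> x \<and> z \<le> y" if xy: "x \<in> G" "y \<in> G" for x y
  proof -
    obtain u d v e where x: "x = u - d" "d \<in> D" "\<forall>x\<in>D. x \<le> u"
      and y: "y = v - e" "e \<in> D" "\<forall>x\<in>D. x \<le> v"
      using xy by (auto simp: G_def)
    obtain c where c: "c \<in> D" "d \<le> c" "e \<le> c"
      using dir x(2) y(2) by blast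
    have "inf u v - c \<in> G"
      unfolding G_def using c x y by fastforce
    moreover have "inf u v - c \<le> x" "inf u v - c \<le> y"
      using c x y by (auto intro!: diff_mono)
    ultimately show ?thesis by blast
  qed
  have posG: "0 \<le> x" if "x \<in> G" for x
    using that by (auto simp: G_def)
  have infG: "b \<le> 0" if b: "\<forall>x\<in>G. b \<le> x" for b
  proof -
    obtain d where d: "d \<in> D" using assms(2) by blast
    have ub: "x \<le> w - of_nat n *\<^sub>R b" if "x \<in> D" for n x
      using that
    proof (induction n arbitrary: x)
      case 0
      then show ?case using bdd by simp
    next
      case (Suc n)
      have "w - of_nat n *\<^sub>R b - x \<in> G"
        unfolding G_def using Suc by blast
      with b have "b \<le> w - of_nat n *\<^sub>R b - x" by blast
      then show ?case by (simp add: algebra_simps)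
    qed
    have "of_nat n *\<^sub>R b \<le> w - d" for n
      using ub[OF d, of n] by (simp add: algebra_simps)
    then show ?thesis by (rule lattice_archimedean)
  qed
  have "(INF x\<in>G. norm x) = 0"
    using oc[unfolded order_continuous_norm_def, rule_format, OF ne] dirG posG infG by simp
  moreover have "bdd_below (norm ` G)" by (rule bdd_belowI[of _ 0]) auto
  ultimately have "\<exists>x\<in>G. norm x < e"
    using cINF_less_iff[of G norm e] ne \<open>e > 0\<close> by simp
  then show ?thesis
    using that by (auto simp: G_def)
qed

text \<open>An order continuous norm makes the lattice Dedekind complete, and a directed supremum is even the
  norm limit of a sequence in the set: elements of \<open>D\<close> that are almost upper bounds form a Cauchy
  sequence, because any two of them lie below a common element of \<open>D\<close> and are close to it.\<close>

lemma directed_sup: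
  fixes D :: "'a::banach_lattice set"
  assumes oc: "order_continuous_norm TYPE('a)"
    and "D \<noteq> {}" and dir: "\<And>x y. x \<in> D \<Longrightarrow> y \<in> D \<Longrightarrow> \<exists>z\<in>D. x \<le> z \<and> y \<le> z"
    and bdd: "\<And>x. x \<in> D \<Longrightarrow> x \<le> w"
  obtains s d where "\<And>x. x \<in> D \<Longrightarrow> x \<le> s" "\<And>u. (\<And>x. x \<in> D \<Longrightarrow> x \<le> u) \<Longrightarrow> s \<le> u"
    "\<And>n::nat. d n \<in> D" "d \<longlonglongrightarrow> s"
proof -
  have "\<exists>u d. d \<in> D \<and> (\<forall>x\<in>D. x \<le> u) \<and> norm (u - d) < inverse (real (Suc n))" for n
    by (rule sup_gap_small[OF oc assms(2) dir bdd, of "inverse (real (Suc n))"]) auto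
  then obtain u d where d: "\<And>n. d n \<in> D" and u: "\<And>n x. x \<in> D \<Longrightarrow> x \<le> u n"
    and small: "\<And>n. norm (u n - d n) < inverse (real (Suc n))"
    by metis
  have above: "norm (z - d n) < inverse (real (Suc n))" if "z \<in> D" "d n \<le> z" for z n
    by (rule le_less_trans[OF norm_mono_nonneg small]) (use that u in \<open>auto intro: diff_right_mono\<close>)
  have dist: "norm (d n - d m) < inverse (real (Suc n)) + inverse (real (Suc m))" for n m
  proof -
    obtain z where z: "z \<in> D" "d n \<le> z" "d m \<le> z" using dir d by blast
    have "norm ((z - d m) - (z - d n)) \<le> norm (z - d m) + norm (z - d n)"
      by (rule norm_triangle_ineq4)
    then have "norm (d n - d m) \<le> norm (z - d m) + norm (z - d n)" by simp
    then show ?thesis using above[OF z(1,2)] above[OF z(1,3)] by linarith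
  qed
  have "Cauchy d"
  proof (rule CauchyI)
    fix e :: real assume "0 < e"
    then obtain N where N: "inverse (real (Suc N)) < e / 2"
      using reals_Archimedean half_gt_zero by blast
    have "norm (d n - d m) < e" if "n \<ge> N" "m \<ge> N" for n m
    proof -
      have "inverse (real (Suc n)) \<le> inverse (real (Suc N))"
        "inverse (real (Suc m)) \<le> inverse (real (Suc N))"
        using that by (auto intro!: le_imp_inverse_le)
      then show ?thesis using N dist[of n m] by linarith
    qed
    then show "\<exists>M. \<forall>m\<ge>M. \<forall>n\<ge>M. norm (d m - d n) < e" by blast
  qed
  then obtain s where s: "d \<longlonglongrightarrow> s"
    using Cauchy_convergent convergent_def by blast
  have gap: "(\<lambda>n. u n - d n) \<longlonglongrightarrow> 0"
    by (rule Lim_null_comparison[OF _ LIMSEQ_inverse_real_of_nat])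
      (use small in \<open>simp add: less_imp_le\<close>)
  have ub: "x \<le> s" if "x \<in> D" for x
    by (rule tendsto_le_lattice[of "\<lambda>_. x" _ sequentially "\<lambda>n. (u n - d n) + d n"])
      (use u that tendsto_add[OF gap s] in simp_all)
  have least: "s \<le> v" if "\<And>x. x \<in> D \<Longrightarrow> x \<le> v" for v
    by (rule tendsto_le_lattice[OF s tendsto_const]) (use d that in simp_all)
  show ?thesis by (rule that[OF ub least d s])
qed

lemma increasing_bounded_convergent:
  fixes x :: "nat \<Rightarrow> 'a::banach_lattice"
  assumes oc: "order_continuous_norm TYPE('a)" and "mono x" and "\<And>n. x n \<le> w"
  obtains s where "x \<longlonglongrightarrow> s" "\<And>n. x n \<le> s" "s \<le> w"
proof -
  have dir: "\<exists>z\<in>range x. a \<le> z \<and> b \<le> z" if "a \<in> range x" "b \<in> range x" for a b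
  proof -
    from that obtain i j where "a = x i" "b = x j" by blast
    then have "a \<le> x (max i j)" "b \<le> x (max i j)"
      using \<open>mono x\<close> by (simp_all add: monoD)
    then show ?thesis by blast
  qed
  obtain s d where sd: "\<And>y. y \<in> range x \<Longrightarrow> y \<le> s"
    "\<And>u. (\<And>y. y \<in> range x \<Longrightarrow> y \<le> u) \<Longrightarrow> s \<le> u" "\<And>n::nat. d n \<in> range x" "d \<longlonglongrightarrow> s"
    by (rule directed_sup[OF oc _ dir, of w]) (use assms(3) in auto)
  have "x \<longlonglongrightarrow> s"
  proof (rule LIMSEQ_I)
    fix e :: real assume "0 < e"
    then obtain k where k: "norm (d k - s) < e"
      using LIMSEQ_D[OF sd(4)] by blast
    obtain N where N: "d k = x N" using sd(3) by blast
    have "norm (x n - s) < e" if "n \<ge> N" for n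
    proof -
      have "norm (s - x n) \<le> norm (s - d k)"
        by (rule norm_mono_nonneg) (use sd(1) N that \<open>mono x\<close> in \<open>auto intro!: diff_mono monoD[of x]\<close>)
      then show ?thesis using k by (simp add: norm_minus_commute)
    qed
    then show "\<exists>no. \<forall>n\<ge>no. norm (x n - s) < e" by blast
  qed
  then show ?thesis using that sd(1,2) assms(3) by blast
qed

lemma functional_mono:
  assumes "strictly_positive \<psi>" "x \<le> y"
  shows "\<psi> x \<le> \<psi> y"
proof -
  have "0 \<le> \<psi> (y - x)"
    using assms unfolding strictly_positive_def
    by (metis blinfun.zero_right diff_ge_0_iff_ge less_eq_real_def)
  then show ?thesis by (simp add: blinfun.diff_right)
qed

lemma functional_nonneg:
  assumes "strictly_positive \<psi>" "0 \<le> x"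
  shows "0 \<le> \<psi> x"
  using functional_mono[OF assms] by simp

lemma functional_zeroD:
  assumes "strictly_positive \<psi>" "0 \<le> x" "\<psi> x \<le> 0"
  shows "x = 0"
  using assms unfolding strictly_positive_def by force

text \<open>A Borel--Cantelli argument: the \<open>n\<close>-th vector \<open>s n\<close> is the supremum of the tail \<open>g n, g (n + 1), \<dots>\<close>.
  It exists as a norm limit since the finite suprema increase below \<open>u\<close>, and \<open>\<psi>\<close> of a finite supremum
  is at most the geometric sum of the bounds on the \<open>\<psi> (g j)\<close>.\<close>

lemma summable_dominating_sequence:
  fixes g :: "nat \<Rightarrow> 'a::banach_lattice"
  assumes oc: "order_continuous_norm TYPE('a)" and sp: "strictly_positive \<psi>"
    and g: "\<And>n. 0 \<le> g n" "\<And>n. g n \<le> u" and sm: "\<And>n. \<psi> (g n) \<le> (1/2) ^ n"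
  obtains s where "\<And>n. g n \<le> s n" "antimono s" "\<And>n. 0 \<le> s n" "\<And>n. \<psi> (s n) \<le> 2 * (1/2) ^ n"
proof -
  \<comment> \<open>The supremum of the vectors \<open>g n, \<dots>, g (n + m)\<close>.\<close>
  define p where "p n m = (rec_nat (g n) (\<lambda>j y. sup y (g (n + Suc j))) m)" for n m
  have p0 [simp]: "p n 0 = g n" and pS [simp]: "p n (Suc m) = sup (p n m) (g (n + Suc m))" for n m
    by (simp_all add: p_def)
  have pm: "mono (p n)" for n
    by (rule incseq_SucI) simp
  have pu: "p n m \<le> u" for n m
    by (induction m) (use g in auto)
  have plow: "g (n + i) \<le> p n m" if "i \<le> m" for n i m
  proof -
    have "g (n + i) \<le> p n i" by (cases i) auto
    also have "\<dots> \<le> p n m" using pm that by (rule monoD)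
    finally show ?thesis .
  qed
  have pshift: "p (Suc n) m \<le> p n (Suc m)" for n m
  proof (induction m)
    case 0
    show ?case by simp
  next
    case (Suc m)
    then show ?case
      using plow[of "Suc (Suc m)" "Suc (Suc m)" n] by (auto simp del: pS(1) simp add: pS[of "Suc n"] intro: order_trans[OF Suc monoD[OF pm]])
  qed
  have pval: "\<psi> (p n m) \<le> (\<Sum>j\<le>m. (1/2) ^ (n + j))" for n m
  proof (induction m)
    case 0
    show ?case using sm by simp
  next
    case (Suc m)
    have "0 \<le> p n m" using order_trans[OF g(1) plow[of 0 m n]] by simp
    then have "sup (p n m) (g (n + Suc m)) \<le> p n m + g (n + Suc m)"
      using g(1) by simp
    then have "\<psi> (p n (Suc m)) \<le> \<psi> (p n m) + \<psi> (g (n + Suc m))"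
      using functional_mono[OF sp] by (metis blinfun.add_right pS)
    then show ?case using Suc sm[of "n + Suc m"] by simp
  qed
  have geo: "(\<Sum>j\<le>m. (1/2::real) ^ (n + j)) \<le> 2 * (1/2) ^ n" for n m
  proof -
    have "(\<Sum>j\<le>m. (1/2::real) ^ (n + j)) = (1/2)^n * (\<Sum>j\<le>m. (1/2) ^ j)"
      by (simp add: power_add sum_distrib_left)
    also have "\<dots> \<le> (1/2)^n * 2"
      using sum_gp0[of "1/2::real" m] by (intro mult_left_mono) simp_all
    finally show ?thesis by simp
  qed
  have "\<exists>s. p n \<longlonglongrightarrow> s \<and> (\<forall>m. p n m \<le> s)" for n
    using increasing_bounded_convergent[OF oc pm pu] by metis
  then obtain s where s: "\<And>n. p n \<longlonglongrightarrow> s n" "\<And>n m. p n m \<le> s n"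
    by metis
  have "g n \<le> s n" for n using s(2)[of n 0] by simp
  moreover have "antimono s"
    by (rule decseq_SucI, rule tendsto_le_lattice[OF s(1) tendsto_const])
      (use order_trans[OF pshift s(2)] in auto)
  moreover have "\<psi> (s n) \<le> 2 * (1/2) ^ n" for n
  proof (rule LIMSEQ_le_const2)
    show "(\<lambda>m. \<psi> (p n m)) \<longlonglongrightarrow> \<psi> (s n)"
      using s(1) by (intro tendsto_intros)
  qed (use order_trans[OF pval geo] in blast)
  ultimately show ?thesis using that g(1) order_trans by metis
qed

text \<open>On an order interval, the weak norm \<open>\<psi> \<bar>x\<bar>\<close> controls the norm of \<open>'a\<close>. Otherwise there are vectors
  \<open>g n\<close> in the interval with norms bounded away from \<open>0\<close> and \<open>\<psi> (g n)\<close> summable. The suprema of their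
  tails decrease to a positive vector which \<open>\<psi>\<close> maps to \<open>0\<close>, so they tend to \<open>0\<close> in norm, although they
  dominate the \<open>g n\<close>.\<close>

lemma order_interval_norm_small:
  fixes u :: "'a::banach_lattice"
  assumes oc: "order_continuous_norm TYPE('a)" and sp: "strictly_positive \<psi>" and "0 < e"
  obtains d where "0 < d" "\<And>g. 0 \<le> g \<Longrightarrow> g \<le> u \<Longrightarrow> \<psi> g < d \<Longrightarrow> norm g < e"
proof (rule ccontr)
  assume "\<not> thesis"
  then have "\<exists>g. 0 \<le> g \<and> g \<le> u \<and> \<psi> g < (1/2) ^ n \<and> e \<le> norm g" for n :: nat
    using that[of "(1/2)^n"] by (force simp: not_less)
  then obtain g where g: "\<And>n. 0 \<le> g n" "\<And>n. g n \<le> u" "\<And>n::nat. \<psi> (g n) < (1/2) ^ n"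
    "\<And>n. e \<le> norm (g n)"
    by metis
  obtain s where s: "\<And>n. g n \<le> s n" "antimono s" "\<And>n. 0 \<le> s n" "\<And>n. \<psi> (s n) \<le> 2 * (1/2) ^ n"
    by (rule summable_dominating_sequence[OF oc sp g(1,2)]) (use g(3) less_imp_le in blast)+
  have "mono (\<lambda>n. - s n)" using s(2) by (simp add: monotone_def)
  then obtain l where l: "(\<lambda>n. - s n) \<longlonglongrightarrow> l" "l \<le> 0"
    by (rule increasing_bounded_convergent[OF oc, of _ 0]) (use s(3) in auto)
  then have lim: "s \<longlonglongrightarrow> - l" using tendsto_minus by fastforce
  have "\<psi> (- l) \<le> 0"
  proof (rule LIMSEQ_le)
    show "(\<lambda>n. \<psi> (s n)) \<longlonglongrightarrow> \<psi> (- l)" using lim by (intro tendsto_intros)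
    show "(\<lambda>n. 2 * (1/2) ^ n :: real) \<longlonglongrightarrow> 0"
      by (intro tendsto_mult_right_zero LIMSEQ_realpow_zero) auto
  qed (use s(4) in auto)
  then have "- l = 0" by (intro functional_zeroD[OF sp]) (use l(2) in simp_all)
  then have "(\<lambda>n. norm (s n)) \<longlonglongrightarrow> 0" using tendsto_norm[OF lim] by simp
  moreover have "e \<le> norm (s n)" for n
    using norm_mono_nonneg[OF g(1) s(1)] g(4) order_trans by blast
  ultimately have "e \<le> 0" by (intro LIMSEQ_le_const) auto
  then show False using \<open>0 < e\<close> by simp
qed

section \<open>Dominated semigroups and limits along the time set\<close>

lemma eventually_infty_in: "eventually Q (infty_in J) \<longleftrightarrow> (\<exists>N. \<forall>t\<in>J. N \<le> t \<longrightarrow> Q t)"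
  unfolding infty_in_def eventually_inf_principal eventually_at_top_linorder by blast

locale dominated_semigroup =
  fixes T :: "real \<Rightarrow> 'a::banach_lattice \<Rightarrow>\<^sub>L 'a"
    and J :: "real set"
    and f\<^sub>0 :: 'a
    and \<psi> :: "'a \<Rightarrow>\<^sub>L real"
    and M :: real
  assumes order_continuous: "order_continuous_norm TYPE('a)"
    and time: "J = real ` {1..} \<or> J = {0<..}"
    and semigroup: "op_semigroup J T"
    and bounded: "bounded_family J T"
    and positive: "positive_family J T"
    and M_pos: "M > 0"
    and quasi_interior: "quasi_interior_point f\<^sub>0"
    and strict: "strictly_positive \<psi>"
    and T_dom: "\<And>t. t \<in> J \<Longrightarrow> T t f\<^sub>0 \<le> M *\<^sub>R f\<^sub>0"
    and dual_dom: "\<And>t. t \<in> J \<Longrightarrow> dual_le (dual_op (T t) \<psi>) (M *\<^sub>R \<psi>)"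
begin

lemma time_pos: "t \<in> J \<Longrightarrow> 0 < t"
  using time by auto

lemma time_add: "s \<in> J \<Longrightarrow> t \<in> J \<Longrightarrow> s + t \<in> J"
  using time
proof
  assume J: "J = real ` {1..}" and "s \<in> J" "t \<in> J"
  then obtain m n where mn: "s = real m" "t = real n" "1 \<le> m" "1 \<le> n" by auto
  then have "s + t = real (m + n)" "1 \<le> m + n" by simp_all
  then show ?thesis unfolding J by blast
qed auto

lemma time_diff: "s \<in> J \<Longrightarrow> t \<in> J \<Longrightarrow> s < t \<Longrightarrow> t - s \<in> J"
  using time
proof
  assume J: "J = real ` {1..}" and "s \<in> J" "t \<in> J" "s < t"
  then obtain m n where mn: "s = real m" "t = real n" "1 \<le> m" "1 \<le> n" "m < n" by auto
  then have "t - s = real (n - m)" "1 \<le> n - m" by (simp_all add: of_nat_diff)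
  then show ?thesis unfolding J by blast
qed auto

lemma time_ex_ge: "\<exists>t\<in>J. N \<le> t"
  using time
proof
  assume J: "J = real ` {1..}"
  obtain n :: nat where "N \<le> real n" using real_arch_simple by blast
  moreover have "real (Suc n) \<in> J" unfolding J by (intro imageI) simp
  ultimately show ?thesis by (intro bexI[of _ "real (Suc n)"]) simp_all
next
  assume "J = {0<..}"
  then show ?thesis by (intro bexI[of _ "max N 1"]) auto
qed

lemma infty_in_neq_bot: "infty_in J \<noteq> bot"
  using time_ex_ge unfolding trivial_limit_def eventually_infty_in by auto

lemma eventually_in_time: "eventually (\<lambda>t. t \<in> J) (infty_in J)"
  by (auto simp: eventually_infty_in)

lemma eventually_shift:
  assumes "s \<in> J" "eventually Q (infty_in J)"
  shows "eventually (\<lambda>t. t - s \<in> J \<and> Q (t - s)) (infty_in J)"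
proof -
  obtain N where N: "\<And>t. t \<in> J \<Longrightarrow> N \<le> t \<Longrightarrow> Q t"
    using assms(2) unfolding eventually_infty_in by blast
  have "t - s \<in> J \<and> Q (t - s)" if "t \<in> J" "max (N + s) (s + 1) \<le> t" for t
    using N time_diff[OF assms(1) that(1)] that(2) by auto
  then show ?thesis unfolding eventually_infty_in by blast
qed

lemma T_add: "s \<in> J \<Longrightarrow> t \<in> J \<Longrightarrow> T (s + t) x = T s (T t x)"
  using semigroup by (simp add: op_semigroup_def)

lemma T_shift:
  assumes "s \<in> J" "t - s \<in> J"
  shows "T t x = T s (T (t - s) x)" "T t x = T (t - s) (T s x)"
  using T_add[OF assms, of x] T_add[OF assms(2,1), of x] by simp_all

lemma T_nonneg: "t \<in> J \<Longrightarrow> 0 \<le> x \<Longrightarrow> 0 \<le> T t x"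
  using positive by (simp add: positive_family_def)

lemma T_mono: "t \<in> J \<Longrightarrow> x \<le> y \<Longrightarrow> T t x \<le> T t y"
  using T_nonneg[of t "y - x"] by (simp add: blinfun.diff_right)

lemma neg_part_T_le: "t \<in> J \<Longrightarrow> neg_part (T t x) \<le> T t (neg_part x)"
  using T_mono[OF _ minus_le_neg_part[of x], of t]
  by (intro neg_part_least) (simp_all add: T_nonneg neg_part_nonneg blinfun.minus_right)

lemma \<psi>_mono: "x \<le> y \<Longrightarrow> \<psi> x \<le> \<psi> y"
  using strict by (rule functional_mono)

lemma \<psi>_nonneg: "0 \<le> x \<Longrightarrow> 0 \<le> \<psi> x"
  using strict by (rule functional_nonneg)

lemma \<psi>_neg_part_nonneg: "0 \<le> \<psi> (neg_part x)"
  by (simp add: \<psi>_nonneg neg_part_nonneg)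

lemma \<psi>_T_le: "t \<in> J \<Longrightarrow> 0 \<le> x \<Longrightarrow> \<psi> (T t x) \<le> M * \<psi> x"
  using dual_dom[of t] by (simp add: dual_le_def dual_op_def blinfun.scaleR_left)

section \<open>Asymptotic lower bounds of single orbits\<close>

text \<open>This is the convergence in the definition of a lower bound, for a single orbit. It is kept for
  arbitrary \<open>f\<close> and \<open>h\<close> because the proof compares orbits with rescaled and enlarged lower bounds.\<close>

definition asymp_ge :: "'a \<Rightarrow> 'a \<Rightarrow> bool" where
  "asymp_ge f h \<longleftrightarrow> ((\<lambda>t. \<psi> (neg_part (T t f - h))) \<longlongrightarrow> 0) (infty_in J)"

lemma asymp_ge_iff:
  "asymp_ge f h \<longleftrightarrow> (\<forall>e>0. eventually (\<lambda>t. \<psi> (neg_part (T t f - h)) < e) (infty_in J))"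
  by (simp add: asymp_ge_def tendsto_iff dist_real_def \<psi>_neg_part_nonneg)

lemma asymp_geD: "asymp_ge f h \<Longrightarrow> 0 < e \<Longrightarrow> eventually (\<lambda>t. \<psi> (neg_part (T t f - h)) < e) (infty_in J)"
  by (simp add: asymp_ge_iff)

lemma asymp_ge_mono:
  assumes "asymp_ge f h" "h' \<le> h" shows "asymp_ge f h'"
  unfolding asymp_ge_iff
proof (intro allI impI)
  fix e :: real assume "0 < e"
  from asymp_geD[OF assms(1) this]
  show "eventually (\<lambda>t. \<psi> (neg_part (T t f - h')) < e) (infty_in J)"
    by eventually_elim
      (use assms(2) in \<open>auto intro: le_less_trans[OF \<psi>_mono[OF neg_part_antimono]] diff_left_mono\<close>)
qed

lemma asymp_ge_sup:
  assumes "asymp_ge f h" "asymp_ge f h'" shows "asymp_ge f (sup h h')"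
  unfolding asymp_ge_iff
proof (intro allI impI)
  fix e :: real assume "0 < e"
  then have "0 < e / 2" by simp
  from asymp_geD[OF assms(1) this] asymp_geD[OF assms(2) this]
  show "eventually (\<lambda>t. \<psi> (neg_part (T t f - sup h h')) < e) (infty_in J)"
  proof eventually_elim
    case (elim t)
    then show ?case
      using \<psi>_mono[OF neg_part_diff_sup_le, of "T t f" h h'] by (simp add: blinfun.add_right)
  qed
qed

lemma asymp_ge_T:
  assumes "asymp_ge f h" "s \<in> J" shows "asymp_ge f (T s h)"
  unfolding asymp_ge_iff
proof (intro allI impI)
  fix e :: real assume "0 < e"
  then have "0 < e / M" using M_pos by simp
  from eventually_shift[OF assms(2) asymp_geD[OF assms(1) this]]
  show "eventually (\<lambda>t. \<psi> (neg_part (T t f - T s h)) < e) (infty_in J)"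
  proof eventually_elim
    case (elim t)
    have "T t f - T s h = T s (T (t - s) f - h)"
      using T_shift(1)[OF assms(2)] elim by (simp add: blinfun.diff_right)
    then have "\<psi> (neg_part (T t f - T s h)) \<le> \<psi> (T s (neg_part (T (t - s) f - h)))"
      using \<psi>_mono[OF neg_part_T_le[OF assms(2)]] by simp
    also have "\<dots> \<le> M * \<psi> (neg_part (T (t - s) f - h))"
      by (rule \<psi>_T_le[OF assms(2) neg_part_nonneg])
    also have "\<dots> < e"
      using elim M_pos by (simp add: pos_less_divide_eq mult.commute)
    finally show ?case .
  qed
qed

text \<open>The asymptotic lower bounds of an orbit are closed even for the one-sided distance
  \<open>\<psi> (neg_part (h' - h))\<close>, which is weaker than the norm.\<close>

lemma asymp_ge_approx:
  assumes "\<And>e. 0 < e \<Longrightarrow> \<exists>h'. asymp_ge f h' \<and> \<psi> (neg_part (h' - h)) < e"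
  shows "asymp_ge f h"
  unfolding asymp_ge_iff
proof (intro allI impI)
  fix e :: real assume "0 < e"
  then have e2: "0 < e / 2" by simp
  then obtain h' where h': "asymp_ge f h'" "\<psi> (neg_part (h' - h)) < e / 2" using assms by blast
  from asymp_geD[OF h'(1) e2]
  show "eventually (\<lambda>t. \<psi> (neg_part (T t f - h)) < e) (infty_in J)"
  proof eventually_elim
    case (elim t)
    then show ?case
      using \<psi>_mono[OF neg_part_add_le, of "T t f - h'" "h' - h"] h'(2) by (simp add: blinfun.add_right)
  qed
qed

lemma asymp_ge_LIMSEQ:
  assumes "\<And>n::nat. asymp_ge f (d n)" "d \<longlonglongrightarrow> h" shows "asymp_ge f h"
proof (rule asymp_ge_approx)
  fix e :: real assume "0 < e"
  have "(\<lambda>n. neg_part (d n - h)) \<longlonglongrightarrow> 0"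
    by (rule Lim_null_comparison[OF always_eventually[OF allI[OF norm_neg_part_le]]])
      (use assms(2) in \<open>simp add: LIM_zero tendsto_norm_zero\<close>)
  then have "(\<lambda>n. \<psi> (neg_part (d n - h))) \<longlonglongrightarrow> \<psi> 0"
    by (intro tendsto_intros)
  then have "eventually (\<lambda>n. \<psi> (neg_part (d n - h)) < e) sequentially"
    using \<open>0 < e\<close> by (simp add: order_tendstoD(2))
  then show "\<exists>h'. asymp_ge f h' \<and> \<psi> (neg_part (h' - h)) < e"
    using assms(1) eventually_happens'[OF sequentially_bot] by blast
qed

lemma asymp_ge_scaleR:
  assumes "asymp_ge f h" "0 \<le> c" shows "asymp_ge (c *\<^sub>R f) (c *\<^sub>R h)"
proof -
  have "neg_part (T t (c *\<^sub>R f) - c *\<^sub>R h) = c *\<^sub>R neg_part (T t f - h)" for t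
    using neg_part_scaleR[OF assms(2)] by (simp add: blinfun.scaleR_right flip: scaleR_right_diff_distrib)
  then show ?thesis
    using tendsto_mult[OF tendsto_const[of c] assms(1)[unfolded asymp_ge_def]]
    by (simp add: asymp_ge_def blinfun.scaleR_right)
qed

lemma asymp_ge_le:
  assumes "asymp_ge f h" "\<And>t. t \<in> J \<Longrightarrow> T t f \<le> u" shows "h \<le> u"
proof -
  have "\<psi> (neg_part (u - h)) \<le> 0"
  proof (rule tendsto_lowerbound[OF assms(1)[unfolded asymp_ge_def] _ infty_in_neq_bot])
    show "eventually (\<lambda>t. \<psi> (neg_part (u - h)) \<le> \<psi> (neg_part (T t f - h))) (infty_in J)"
      using eventually_in_time
      by eventually_elim (auto intro!: \<psi>_mono neg_part_antimono diff_right_mono assms(2))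
  qed
  then have "neg_part (u - h) = 0"
    by (rule functional_zeroD[OF strict neg_part_nonneg])
  then show ?thesis by (simp add: neg_part_eq_0_iff)
qed

lemma asymp_ge_\<psi>_le:
  assumes "asymp_ge f h" "0 \<le> f" shows "\<psi> h \<le> M * \<psi> f"
proof -
  have "((\<lambda>t. M * \<psi> f + \<psi> (neg_part (T t f - h))) \<longlongrightarrow> M * \<psi> f + 0) (infty_in J)"
    using assms(1) unfolding asymp_ge_def by (intro tendsto_intros)
  moreover have "eventually (\<lambda>t. \<psi> h \<le> M * \<psi> f + \<psi> (neg_part (T t f - h))) (infty_in J)"
    using eventually_in_time
  proof eventually_elim
    case (elim t)
    have "\<psi> (h - T t f) \<le> \<psi> (neg_part (T t f - h))"
      using \<psi>_mono[OF minus_le_neg_part[of "T t f - h"]] by simp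
    then show ?case
      using \<psi>_T_le[OF elim assms(2)] by (simp add: blinfun.diff_right)
  qed
  ultimately show ?thesis
    using tendsto_lowerbound infty_in_neq_bot by fastforce
qed

section \<open>A fixed point among the lower bounds\<close>

lemma lower_bound_iff:
  "lower_bound J T \<psi> h \<longleftrightarrow> 0 \<le> h \<and> (\<forall>f\<ge>0. \<psi> f = 1 \<longrightarrow> asymp_ge f h)"
  by (simp add: lower_bound_def asymp_ge_def)

lemma lower_bound_asymp_ge:
  assumes "lower_bound J T \<psi> h" "0 \<le> f"
  shows "asymp_ge f (\<psi> f *\<^sub>R h)"
proof (cases "f = 0")
  case True
  then show ?thesis by (simp add: asymp_ge_def neg_part_def)
next
  case False
  then have pos: "0 < \<psi> f" using strict assms(2) by (simp add: strictly_positive_def)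
  let ?g = "inverse (\<psi> f) *\<^sub>R f"
  have "asymp_ge ?g h"
    using assms pos by (simp add: lower_bound_iff blinfun.scaleR_right scaleR_nonneg_nonneg)
  from asymp_ge_scaleR[OF this, of "\<psi> f"] pos show ?thesis by simp
qed

lemma f0_nonneg: "0 \<le> f\<^sub>0"
  using quasi_interior by (simp add: quasi_interior_point_def)

lemma \<psi>_f0_pos:
  assumes "(h::'a) \<noteq> 0" shows "0 < \<psi> f\<^sub>0"
proof -
  have "f\<^sub>0 \<noteq> 0"
  proof
    assume "f\<^sub>0 = 0"
    then have "principal_ideal f\<^sub>0 \<subseteq> {0}" by (auto simp: principal_ideal_def)
    then have "closure (principal_ideal f\<^sub>0) \<subseteq> {0}"
      by (metis closed_singleton closure_minimal)
    then show False using quasi_interior assms by (auto simp: quasi_interior_point_def)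
  qed
  then show ?thesis using f0_nonneg strict by (simp add: strictly_positive_def)
qed

text \<open>Lower bounds also bound the orbit of \<open>f\<^sub>0\<close>, which never leaves the order interval below
  \<open>M *\<^sub>R f\<^sub>0\<close>. This order bound is what makes suprema of lower bounds available.\<close>

lemma lower_bound_le_f0:
  assumes "lower_bound J T \<psi> h" "0 < \<psi> f\<^sub>0"
  shows "h \<le> (M / \<psi> f\<^sub>0) *\<^sub>R f\<^sub>0"
proof -
  have "\<psi> f\<^sub>0 *\<^sub>R h \<le> M *\<^sub>R f\<^sub>0"
    by (rule asymp_ge_le[OF lower_bound_asymp_ge[OF assms(1) f0_nonneg] T_dom])
  from scaleR_left_mono[OF this, of "inverse (\<psi> f\<^sub>0)"] assms(2) show ?thesis
    by (simp add: divide_inverse mult.commute)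
qed

text \<open>The lower bounds are closed under finite suprema and norm limits, hence under the supremum of
  all of them.\<close>

lemma greatest_lower_bound_vector:
  assumes "lower_bound J T \<psi> h" "h \<noteq> 0"
  obtains g where "lower_bound J T \<psi> g" "\<And>h. lower_bound J T \<psi> h \<Longrightarrow> h \<le> g"
proof -
  let ?L = "Collect (lower_bound J T \<psi>)"
  have dir: "\<exists>z\<in>?L. x \<le> z \<and> y \<le> z" if "x \<in> ?L" "y \<in> ?L" for x y
    using that by (intro bexI[of _ "sup x y"]) (auto simp: lower_bound_iff asymp_ge_sup le_supI1)
  have bdd: "x \<le> (M / \<psi> f\<^sub>0) *\<^sub>R f\<^sub>0" if "x \<in> ?L" for x
    using lower_bound_le_f0 \<psi>_f0_pos[OF assms(2)] that by simp
  have ne: "?L \<noteq> {}" using assms(1) by blast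
  obtain g d where g: "\<And>x. x \<in> ?L \<Longrightarrow> x \<le> g" "\<And>u. (\<And>x. x \<in> ?L \<Longrightarrow> x \<le> u) \<Longrightarrow> g \<le> u"
    "\<And>n::nat. d n \<in> ?L" "d \<longlonglongrightarrow> g"
    by (rule directed_sup[OF order_continuous ne dir bdd]) blast+
  have "0 \<le> h" "h \<le> g" using g(1)[of h] assms(1) by (simp_all add: lower_bound_iff)
  then have "0 \<le> g" by (rule order_trans)
  then have "lower_bound J T \<psi> g"
    using g(3) asymp_ge_LIMSEQ[OF _ g(4)] by (auto simp: lower_bound_iff)
  then show ?thesis using that g(1) by simp
qed

text \<open>The image of a lower bound under \<open>T s\<close> is a lower bound, so the greatest lower bound \<open>h\<close> satisfies
  \<open>T s h \<le> h\<close> and its orbit decreases. The limit \<open>k\<close> of the orbit is a fixed point, and again a lower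
  bound. It is not zero: \<open>\<psi> h *\<^sub>R h\<close> lies asymptotically below the orbit of \<open>h\<close>, hence below
  every point of this decreasing orbit, hence below \<open>k\<close>.\<close>

lemma fixed_lower_bound:
  assumes "lower_bound J T \<psi> h\<^sub>0" "h\<^sub>0 \<noteq> 0"
  obtains k where "lower_bound J T \<psi> k" "k \<noteq> 0" "\<And>t. t \<in> J \<Longrightarrow> T t k = k"
proof -
  obtain h where h: "lower_bound J T \<psi> h" "\<And>h'. lower_bound J T \<psi> h' \<Longrightarrow> h' \<le> h"
    using greatest_lower_bound_vector[OF assms] by blast
  have h_nonneg: "0 \<le> h" using h(1) by (simp add: lower_bound_iff)
  have "0 < \<psi> h\<^sub>0"
    using assms strict by (simp add: lower_bound_iff strictly_positive_def)
  then have \<psi>h: "0 < \<psi> h" using \<psi>_mono[OF h(2)[OF assms(1)]] by simp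
  have lbT: "lower_bound J T \<psi> (T s h)" if "s \<in> J" for s
    using h(1) that by (auto simp: lower_bound_iff T_nonneg asymp_ge_T)
  have Th: "T s h \<le> h" if "s \<in> J" for s
    using h(2) lbT that by blast
  have dec: "T (s + t) h \<le> T s h" "T (s + t) h \<le> T t h" if "s \<in> J" "t \<in> J" for s t
    using T_add[OF that, of h] T_add[OF that(2,1), of h] T_mono[OF that(1) Th[OF that(2)]]
      T_mono[OF that(2) Th[OF that(1)]]
    by (simp_all add: add.commute)
  let ?D = "(\<lambda>s. - T s h) ` J"
  have dir: "\<exists>z\<in>?D. x \<le> z \<and> y \<le> z" if "x \<in> ?D" "y \<in> ?D" for x y
  proof -
    from that obtain s t where st: "s \<in> J" "t \<in> J" "x = - T s h" "y = - T t h" by blast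
    then show ?thesis
      using dec[OF st(1,2)] time_add[OF st(1,2)] by (intro bexI[of _ "- T (s + t) h"]) auto
  qed
  have bdd: "x \<le> 0" if "x \<in> ?D" for x
    using that h_nonneg T_nonneg by auto
  have ne: "?D \<noteq> {}" using time_ex_ge by blast
  obtain l d where l: "\<And>x. x \<in> ?D \<Longrightarrow> x \<le> l"
    "\<And>u. (\<And>x. x \<in> ?D \<Longrightarrow> x \<le> u) \<Longrightarrow> l \<le> u" "\<And>n::nat. d n \<in> ?D" "d \<longlonglongrightarrow> l"
    by (rule directed_sup[OF order_continuous ne dir bdd]) blast+
  define k where "k = - l"
  have k_le: "k \<le> T s h" if "s \<in> J" for s
    using l(1)[of "- T s h"] that by (simp add: k_def minus_le_iff)
  have k_greatest: "u \<le> k" if "\<And>s. s \<in> J \<Longrightarrow> u \<le> T s h" for u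
  proof -
    have "l \<le> - u" by (rule l(2)) (use that in auto)
    then show ?thesis by (simp add: k_def le_minus_iff)
  qed
  obtain s where s: "\<And>n. s n \<in> J" "\<And>n. d n = - T (s n) h"
  proof -
    have "\<exists>s. s \<in> J \<and> d n = - T s h" for n using l(3)[of n] by blast
    then show thesis using that by metis
  qed
  have lim: "(\<lambda>n. T (s n) h) \<longlonglongrightarrow> k"
    using tendsto_minus[OF l(4)] s(2) by (simp add: k_def)
  have "\<psi> h *\<^sub>R h \<le> T r h" if r: "r \<in> J" for r
  proof -
    have "\<psi> (neg_part (T r h - \<psi> h *\<^sub>R h)) \<le> e" if e: "0 < e" for e
    proof -
      obtain t where t: "t \<in> J" "\<psi> (neg_part (T (t + r) h - \<psi> h *\<^sub>R h)) < e"
      proof -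
        from asymp_geD[OF lower_bound_asymp_ge[OF h(1) h_nonneg] e] obtain N where
          N: "\<And>t. t \<in> J \<Longrightarrow> N \<le> t \<Longrightarrow> \<psi> (neg_part (T t h - \<psi> h *\<^sub>R h)) < e"
          unfolding eventually_infty_in by blast
        obtain t where "t \<in> J" "N \<le> t" using time_ex_ge by blast
        then show thesis using that[of t] N[OF time_add[OF _ r]] time_pos[OF r] by simp
      qed
      have "\<psi> (neg_part (T r h - \<psi> h *\<^sub>R h)) \<le> \<psi> (neg_part (T (t + r) h - \<psi> h *\<^sub>R h))"
        using dec(2)[OF t(1) r] by (intro \<psi>_mono neg_part_antimono diff_right_mono)
      with t show ?thesis by simp
    qed
    then have "\<psi> (neg_part (T r h - \<psi> h *\<^sub>R h)) \<le> 0" by (rule field_le_epsilon) simp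
    then have "neg_part (T r h - \<psi> h *\<^sub>R h) = 0"
      by (rule functional_zeroD[OF strict neg_part_nonneg])
    then show ?thesis by (simp add: neg_part_eq_0_iff)
  qed
  then have hk: "\<psi> h *\<^sub>R h \<le> k" by (rule k_greatest)
  have "0 < \<psi> h * \<psi> h" using \<psi>h by simp
  then have "0 < \<psi> k" using \<psi>_mono[OF hk] by (simp add: blinfun.scaleR_right)
  then have "k \<noteq> 0" by auto
  have "0 \<le> \<psi> h *\<^sub>R h" using \<psi>h h_nonneg by (simp add: scaleR_nonneg_nonneg)
  then have "0 \<le> k" using hk by (rule order_trans)
  then have "lower_bound J T \<psi> k"
    using lbT[OF s(1)] asymp_ge_LIMSEQ[OF _ lim] by (auto simp: lower_bound_iff)
  moreover have "T r k = k" if r: "r \<in> J" for r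
  proof (rule order_antisym)
    show "T r k \<le> k"
    proof (rule k_greatest)
      fix t assume t: "t \<in> J"
      have "T r k \<le> T r (T t h)" by (rule T_mono[OF r k_le[OF t]])
      also have "\<dots> \<le> T t h" using dec(2)[OF r t] T_add[OF r t] by simp
      finally show "T r k \<le> T t h" .
    qed
    have "(\<lambda>n. T r (T (s n) h)) \<longlonglongrightarrow> T r k" using lim by (intro tendsto_intros)
    then show "k \<le> T r k"
      by (rule tendsto_le_lattice[OF tendsto_const])
        (use k_le[OF time_add[OF r s(1)]] T_add[OF r s(1)] in simp_all)
  qed
  ultimately show ?thesis using that \<open>k \<noteq> 0\<close> by blast
qed


section \<open>Convergence of the orbits\<close>

lemma maximal_multiple:
  assumes "0 \<le> f" "0 \<le> k" "k \<noteq> 0"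
  obtains c where "asymp_ge f (c *\<^sub>R k)" "\<And>b. asymp_ge f (b *\<^sub>R k) \<Longrightarrow> b \<le> c"
proof -
  let ?A = "{c. asymp_ge f (c *\<^sub>R k)}"
  have \<psi>k: "0 < \<psi> k" using assms strict by (simp add: strictly_positive_def)
  have "eventually (\<lambda>t. neg_part (T t f) = 0) (infty_in J)"
    using eventually_in_time by eventually_elim (simp add: neg_part_eq_0_iff T_nonneg assms(1))
  then have "asymp_ge f (0 *\<^sub>R k)"
    unfolding asymp_ge_def by (intro tendsto_eventually) (auto elim: eventually_mono)
  then have ne: "?A \<noteq> {}" by blast
  have "c \<le> M * \<psi> f / \<psi> k" if "c \<in> ?A" for c
    using asymp_ge_\<psi>_le[of f "c *\<^sub>R k"] that assms(1) \<psi>k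
    by (simp add: blinfun.scaleR_right pos_le_divide_eq)
  then have bdd: "bdd_above ?A" by (rule bdd_aboveI)
  have "asymp_ge f (Sup ?A *\<^sub>R k)"
  proof (rule asymp_ge_approx)
    fix e :: real assume "0 < e"
    then have "Sup ?A - e / \<psi> k < Sup ?A" using \<psi>k by simp
    then obtain c where c: "c \<in> ?A" "Sup ?A - e / \<psi> k < c"
      using less_cSup_iff[OF ne bdd] by blast
    have cS: "c \<le> Sup ?A" using c(1) bdd by (rule cSup_upper)
    have "neg_part (c *\<^sub>R k - Sup ?A *\<^sub>R k) \<le> (Sup ?A - c) *\<^sub>R k"
      using cS assms(2) by (intro neg_part_least) (simp_all add: scaleR_left_diff_distrib scaleR_right_mono)
    from \<psi>_mono[OF this] have "\<psi> (neg_part (c *\<^sub>R k - Sup ?A *\<^sub>R k)) \<le> (Sup ?A - c) * \<psi> k"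
      by (simp add: blinfun.scaleR_right)
    also have "\<dots> < e" using c(2) \<psi>k by (simp add: field_simps)
    finally show "\<exists>h'. asymp_ge f h' \<and> \<psi> (neg_part (h' - Sup ?A *\<^sub>R k)) < e"
      using c(1) by blast
  qed
  moreover have "b \<le> Sup ?A" if "asymp_ge f (b *\<^sub>R k)" for b
    by (rule cSup_upper) (use that bdd in simp_all)
  ultimately show ?thesis using that by blast
qed

text \<open>The step that improves a lower bound. Write \<open>T t f = c *\<^sub>R k + r - x\<close> with \<open>r\<close> and \<open>x\<close> the positive
  and negative parts of the difference, at a time \<open>t\<close> when \<open>\<psi> r \<ge> \<delta>\<close> and \<open>\<psi> x\<close> is small. From then
  on \<open>c *\<^sub>R k\<close> stays fixed, the orbit of \<open>r\<close> is asymptotically above \<open>\<delta> *\<^sub>R k\<close> because \<open>k\<close> is a lower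
  bound, and the orbit of \<open>x\<close> stays small in the weak norm.\<close>

lemma asymp_ge_add_excess:
  assumes k: "lower_bound J T \<psi> k" "\<And>t. t \<in> J \<Longrightarrow> T t k = k"
    and "asymp_ge f (c *\<^sub>R k)" "0 < \<delta>"
    and freq: "\<exists>\<^sub>F t in infty_in J. \<delta> \<le> \<psi> (neg_part (c *\<^sub>R k - T t f))"
  shows "asymp_ge f ((c + \<delta>) *\<^sub>R k)"
  unfolding asymp_ge_iff
proof (intro allI impI)
  fix e :: real assume "0 < e"
  then have "0 < e / (2 * M)" using M_pos by simp
  from frequently_eventually_frequently[OF freq eventually_conj[OF eventually_in_time asymp_geD[OF assms(3) this]]]
  obtain t where t: "t \<in> J" "\<delta> \<le> \<psi> (neg_part (c *\<^sub>R k - T t f))"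
    "\<psi> (neg_part (T t f - c *\<^sub>R k)) < e / (2 * M)"
    using frequently_ex by blast
  define x where "x = neg_part (T t f - c *\<^sub>R k)"
  define r where "r = neg_part (c *\<^sub>R k - T t f)"
  have split: "T t f = c *\<^sub>R k + r - x"
    using pos_part_minus_neg_part[of "T t f - c *\<^sub>R k"] by (simp add: x_def r_def algebra_simps)
  have x0: "0 \<le> x" and r0: "0 \<le> r" by (simp_all add: x_def r_def neg_part_nonneg)
  have "0 \<le> k" using k(1) by (simp add: lower_bound_iff)
  then have "asymp_ge r (\<delta> *\<^sub>R k)"
    using asymp_ge_mono[OF lower_bound_asymp_ge[OF k(1) r0]] t(2) by (simp add: r_def scaleR_right_mono)
  then have "eventually (\<lambda>s. s \<in> J \<and> \<psi> (neg_part (T s r - \<delta> *\<^sub>R k)) < e / 2) (infty_in J)"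
    using eventually_conj[OF eventually_in_time asymp_geD[OF _ half_gt_zero[OF \<open>0 < e\<close>]]] by blast
  from eventually_shift[OF t(1) this]
  show "eventually (\<lambda>u. \<psi> (neg_part (T u f - (c + \<delta>) *\<^sub>R k)) < e) (infty_in J)"
  proof eventually_elim
    case (elim u)
    let ?s = "u - t"
    have s: "?s \<in> J" using elim by blast
    have "T u f - (c + \<delta>) *\<^sub>R k = (T ?s r - \<delta> *\<^sub>R k) + (- T ?s x)"
      using T_shift(2)[OF t(1) s, of f] k(2)[OF s]
      by (simp add: split blinfun.diff_right blinfun.add_right blinfun.scaleR_right scaleR_left_distrib)
    then have "neg_part (T u f - (c + \<delta>) *\<^sub>R k) \<le> neg_part (T ?s r - \<delta> *\<^sub>R k) + neg_part (- T ?s x)"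
      by (metis neg_part_add_le)
    also have "neg_part (- T ?s x) \<le> T ?s x"
      using T_nonneg[OF s x0] by (intro neg_part_least) simp_all
    finally have "\<psi> (neg_part (T u f - (c + \<delta>) *\<^sub>R k)) \<le> \<psi> (neg_part (T ?s r - \<delta> *\<^sub>R k)) + \<psi> (T ?s x)"
      using \<psi>_mono by (fastforce simp flip: blinfun.add_right)
    moreover have "\<psi> (T ?s x) < e / 2"
      using \<psi>_T_le[OF s x0] t(3) M_pos by (simp add: x_def field_simps)
    ultimately show ?case using elim by simp
  qed
qed

text \<open>For the largest \<open>c\<close> with \<open>c *\<^sub>R k\<close> asymptotically below the orbit, an excess over \<open>c *\<^sub>R k\<close> that does
  not tend to \<open>0\<close> would contradict maximality by the preceding lemma.\<close>

lemma orbit_tendsto_\<psi>: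
  assumes k: "lower_bound J T \<psi> k" "k \<noteq> 0" "\<And>t. t \<in> J \<Longrightarrow> T t k = k" and "0 \<le> f"
  obtains c where "((\<lambda>t. \<psi> \<bar>T t f - c *\<^sub>R k\<bar>) \<longlongrightarrow> 0) (infty_in J)"
proof -
  have "0 \<le> k" using k(1) by (simp add: lower_bound_iff)
  obtain c where c: "asymp_ge f (c *\<^sub>R k)" "\<And>b. asymp_ge f (b *\<^sub>R k) \<Longrightarrow> b \<le> c"
    using maximal_multiple[OF assms(4) \<open>0 \<le> k\<close> k(2)] by blast
  have "((\<lambda>t. \<psi> (neg_part (c *\<^sub>R k - T t f))) \<longlongrightarrow> 0) (infty_in J)"
  proof (rule tendstoI)
    fix e :: real assume "0 < e"
    have "\<not> (\<exists>\<^sub>F t in infty_in J. e \<le> \<psi> (neg_part (c *\<^sub>R k - T t f)))"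
      using asymp_ge_add_excess[OF k(1,3) c(1) \<open>0 < e\<close>] c(2)[of "c + e"] \<open>0 < e\<close> by auto
    then show "\<forall>\<^sub>F t in infty_in J. dist (\<psi> (neg_part (c *\<^sub>R k - T t f))) 0 < e"
      by (simp add: not_frequently not_le dist_real_def \<psi>_neg_part_nonneg)
  qed
  from tendsto_add[OF this c(1)[unfolded asymp_ge_def]]
  have "((\<lambda>t. \<psi> \<bar>T t f - c *\<^sub>R k\<bar>) \<longlongrightarrow> 0) (infty_in J)"
    by (simp add: abs_eq_parts blinfun.add_right)
  then show ?thesis by (rule that)
qed

lemma orbit_tendsto_norm:
  assumes k: "lower_bound J T \<psi> k" "k \<noteq> 0" "\<And>t. t \<in> J \<Longrightarrow> T t k = k"
    and f: "0 \<le> f" "f \<le> b *\<^sub>R f\<^sub>0" "0 \<le> b"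
  shows "\<exists>c. ((\<lambda>t. T t f) \<longlongrightarrow> c *\<^sub>R k) (infty_in J)"
proof -
  obtain c where c: "((\<lambda>t. \<psi> \<bar>T t f - c *\<^sub>R k\<bar>) \<longlongrightarrow> 0) (infty_in J)"
    by (rule orbit_tendsto_\<psi>[OF k f(1)])
  let ?u = "b *\<^sub>R M *\<^sub>R f\<^sub>0 + \<bar>c *\<^sub>R k\<bar>"
  have bound: "\<bar>T t f - c *\<^sub>R k\<bar> \<le> ?u" if "t \<in> J" for t
  proof -
    have "T t f \<le> b *\<^sub>R T t f\<^sub>0" using T_mono[OF that f(2)] by (simp add: blinfun.scaleR_right)
    also have "\<dots> \<le> b *\<^sub>R M *\<^sub>R f\<^sub>0" using T_dom[OF that] f(3) by (rule scaleR_left_mono)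
    finally have "T t f \<le> b *\<^sub>R M *\<^sub>R f\<^sub>0" .
    then have "T t f + \<bar>c *\<^sub>R k\<bar> \<le> ?u" by (rule add_right_mono)
    moreover have "\<bar>T t f - c *\<^sub>R k\<bar> \<le> T t f + \<bar>c *\<^sub>R k\<bar>"
      using abs_triangle_ineq4[of "T t f" "c *\<^sub>R k"] T_nonneg[OF that f(1)] by simp
    ultimately show ?thesis by (rule order_trans[rotated])
  qed
  have "((\<lambda>t. T t f) \<longlongrightarrow> c *\<^sub>R k) (infty_in J)"
  proof (rule tendstoI)
    fix e :: real assume "0 < e"
    obtain d where d: "0 < d" "\<And>g. 0 \<le> g \<Longrightarrow> g \<le> ?u \<Longrightarrow> \<psi> g < d \<Longrightarrow> norm g < e"
      by (rule order_interval_norm_small[OF order_continuous strict \<open>0 < e\<close>]) blast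
    have "eventually (\<lambda>t. \<psi> \<bar>T t f - c *\<^sub>R k\<bar> < d) (infty_in J)"
      using order_tendstoD(2)[OF c d(1)] .
    then show "eventually (\<lambda>t. dist (T t f) (c *\<^sub>R k) < e) (infty_in J)"
      using eventually_in_time
      by eventually_elim (use d(2)[OF abs_ge_zero bound] in \<open>simp add: dist_norm\<close>)
  qed
  then show ?thesis by blast
qed

lemma norm_T_bound:
  obtains B where "0 < B" "\<And>t x. t \<in> J \<Longrightarrow> norm (T t x) \<le> B * norm x"
proof -
  obtain B where B: "0 < B" "\<And>t. t \<in> J \<Longrightarrow> norm (T t) \<le> B"
    using bounded unfolding bounded_family_def bounded_pos by blast
  have "norm (T t x) \<le> B * norm x" if "t \<in> J" for t x
    by (rule order_trans[OF norm_blinfun mult_right_mono]) (use B(2) that in auto)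
  with B(1) show ?thesis by (rule that)
qed

text \<open>This carries norm convergence from the dense ideal generated by \<open>f\<^sub>0\<close> to the whole space. Since
  the operators are uniformly bounded, the coefficients of the limits depend continuously on the
  starting points.\<close>

lemma closed_orbits_tendsto_multiple:
  assumes "k \<noteq> 0"
  shows "closed {f. \<exists>c. ((\<lambda>t. T t f) \<longlongrightarrow> c *\<^sub>R k) (infty_in J)}" (is "closed ?S")
  unfolding closed_sequential_limits
proof (intro allI impI)
  fix x l assume "(\<forall>n. x n \<in> ?S) \<and> x \<longlonglongrightarrow> l"
  then have xl: "x \<longlonglongrightarrow> l" and "\<forall>n. \<exists>c. ((\<lambda>t. T t (x n)) \<longlongrightarrow> c *\<^sub>R k) (infty_in J)" by auto
  then obtain c where c: "\<And>n. ((\<lambda>t. T t (x n)) \<longlongrightarrow> c n *\<^sub>R k) (infty_in J)" by metis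
  obtain B where B: "0 < B" "\<And>t x. t \<in> J \<Longrightarrow> norm (T t x) \<le> B * norm x"
    by (rule norm_T_bound) blast
  have k0: "0 < norm k" using assms by simp
  have le: "\<bar>c m - c n\<bar> * norm k \<le> B * norm (x m - x n)" for m n
  proof -
    have "norm (c m *\<^sub>R k - c n *\<^sub>R k) \<le> B * norm (x m - x n)"
      by (rule tendsto_upperbound[OF tendsto_norm[OF tendsto_diff[OF c c]] _ infty_in_neq_bot])
        (use eventually_in_time in \<open>eventually_elim, auto simp flip: blinfun.diff_right intro: B(2)\<close>)
    then show ?thesis by (simp flip: scaleR_left_diff_distrib)
  qed
  have "Cauchy c"
  proof (rule CauchyI)
    fix e :: real assume "0 < e"
    then have "0 < e * norm k / B" using k0 B(1) by simp
    then obtain N where N: "\<And>m n. m \<ge> N \<Longrightarrow> n \<ge> N \<Longrightarrow> norm (x m - x n) < e * norm k / B"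
      using CauchyD[OF LIMSEQ_imp_Cauchy[OF xl]] by blast
    have "norm (c m - c n) < e" if "m \<ge> N" "n \<ge> N" for m n
    proof -
      have "\<bar>c m - c n\<bar> * norm k < e * norm k"
        using le[of m n] N[OF that] B(1) by (simp add: field_simps)
      then show ?thesis using k0 by simp
    qed
    then show "\<exists>M. \<forall>m\<ge>M. \<forall>n\<ge>M. norm (c m - c n) < e" by blast
  qed
  then obtain a where a: "c \<longlonglongrightarrow> a" using Cauchy_convergent convergent_def by blast
  have "((\<lambda>t. T t l) \<longlongrightarrow> a *\<^sub>R k) (infty_in J)"
  proof (rule tendstoI)
    fix e :: real assume "0 < e"
    have "(\<lambda>n. B * norm (l - x n) + norm (c n *\<^sub>R k - a *\<^sub>R k)) \<longlonglongrightarrow> B * norm (l - l) + norm (a *\<^sub>R k - a *\<^sub>R k)"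
      using xl a by (intro tendsto_intros)
    then have "eventually (\<lambda>n. B * norm (l - x n) + norm (c n *\<^sub>R k - a *\<^sub>R k) < e / 2) sequentially"
      by (rule order_tendstoD(2)) (use \<open>0 < e\<close> in simp)
    then obtain n where n: "B * norm (l - x n) + norm (c n *\<^sub>R k - a *\<^sub>R k) < e / 2"
      using eventually_happens'[OF sequentially_bot] by blast
    have "eventually (\<lambda>t. dist (T t (x n)) (c n *\<^sub>R k) < e / 2) (infty_in J)"
      by (rule tendstoD[OF c half_gt_zero[OF \<open>0 < e\<close>]])
    then show "eventually (\<lambda>t. dist (T t l) (a *\<^sub>R k) < e) (infty_in J)"
      using eventually_in_time
    proof eventually_elim
      case (elim t)
      have "dist (T t l) (a *\<^sub>R k) \<le> dist (T t l) (T t (x n)) + dist (T t (x n)) (c n *\<^sub>R k) + dist (c n *\<^sub>R k) (a *\<^sub>R k)"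
        by (meson add_right_mono dist_triangle order_trans)
      moreover have "dist (T t l) (T t (x n)) \<le> B * norm (l - x n)"
        using B(2)[OF elim(2)] by (simp add: dist_norm flip: blinfun.diff_right)
      ultimately show ?case using elim(1) n by (simp add: dist_norm)
    qed
  qed
  then show "l \<in> ?S" by blast
qed

lemma orbit_tendsto_multiple:
  assumes k: "lower_bound J T \<psi> k" "k \<noteq> 0" "\<And>t. t \<in> J \<Longrightarrow> T t k = k"
  shows "\<exists>c. ((\<lambda>t. T t f) \<longlongrightarrow> c *\<^sub>R k) (infty_in J)"
proof -
  let ?S = "{f. \<exists>c. ((\<lambda>t. T t f) \<longlongrightarrow> c *\<^sub>R k) (infty_in J)}"
  have "f \<in> ?S" if "f \<in> principal_ideal f\<^sub>0" for f
  proof -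
    from that obtain b where b: "0 < b" "\<bar>f\<bar> \<le> b *\<^sub>R f\<^sub>0" by (auto simp: principal_ideal_def)
    have "neg_part f \<le> b *\<^sub>R f\<^sub>0" "neg_part (- f) \<le> b *\<^sub>R f\<^sub>0"
      using neg_part_le_abs[of f] neg_part_le_abs[of "- f"] b(2) by auto
    then obtain p n where
      p: "((\<lambda>t. T t (neg_part (- f))) \<longlongrightarrow> p *\<^sub>R k) (infty_in J)" and
      n: "((\<lambda>t. T t (neg_part f)) \<longlongrightarrow> n *\<^sub>R k) (infty_in J)"
      using orbit_tendsto_norm[OF k neg_part_nonneg _ less_imp_le[OF b(1)]] by blast
    have "((\<lambda>t. T t f) \<longlongrightarrow> (p - n) *\<^sub>R k) (infty_in J)"
      using tendsto_diff[OF p n]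
      by (simp add: pos_part_minus_neg_part scaleR_left_diff_distrib flip: blinfun.diff_right)
    then show ?thesis by blast
  qed
  then have "closure (principal_ideal f\<^sub>0) \<subseteq> ?S"
    by (intro closure_minimal closed_orbits_tendsto_multiple k) blast
  then show ?thesis using quasi_interior by (auto simp: quasi_interior_point_def)
qed

section \<open>The two implications\<close>

text \<open>The estimate holds with \<open>\<epsilon> = \<psi> k\<close>: asymptotically \<open>T t f\<close> is above \<open>\<psi> f *\<^sub>R k\<close>, so its limit has
  \<open>\<psi>\<close>-value at least \<open>\<psi> f * \<psi> k\<close>.\<close>

lemma rank1_limit_of_fixed_lower_bound:
  assumes k: "lower_bound J T \<psi> k" "k \<noteq> 0" "\<And>t. t \<in> J \<Longrightarrow> T t k = k"
  obtains P \<epsilon> where "strongly_converges J T P" "rank1_projection P"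
    "0 < \<epsilon>" "dual_le (\<epsilon> *\<^sub>R \<psi>) (dual_op P \<psi>)"
proof -
  obtain c where c: "\<And>f. ((\<lambda>t. T t f) \<longlongrightarrow> c f *\<^sub>R k) (infty_in J)"
    using orbit_tendsto_multiple[OF k] by metis
  obtain B where B: "0 < B" "\<And>t x. t \<in> J \<Longrightarrow> norm (T t x) \<le> B * norm x"
    by (rule norm_T_bound) blast
  note uniq = tendsto_unique[OF infty_in_neq_bot]
  have lin: "bounded_linear (\<lambda>f. c f *\<^sub>R k)"
  proof (rule bounded_linear_intro[of _ B])
    show "c (f + g) *\<^sub>R k = c f *\<^sub>R k + c g *\<^sub>R k" for f g
      using uniq[OF c] tendsto_add[OF c[of f] c[of g]] by (simp add: blinfun.add_right)
    show "c (a *\<^sub>R f) *\<^sub>R k = a *\<^sub>R c f *\<^sub>R k" for a f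
      using uniq[OF c] tendsto_scaleR[OF tendsto_const[of a] c[of f]] by (simp add: blinfun.scaleR_right)
    show "norm (c f *\<^sub>R k) \<le> norm f * B" for f
      by (rule tendsto_upperbound[OF tendsto_norm[OF c] _ infty_in_neq_bot])
        (use eventually_in_time in \<open>eventually_elim, auto simp: mult.commute intro: B(2)\<close>)
  qed
  define P where "P = Blinfun (\<lambda>f. c f *\<^sub>R k)"
  have P: "P f = c f *\<^sub>R k" for f
    by (simp add: P_def bounded_linear_Blinfun_apply[OF lin])
  have Pk: "P k = k"
  proof -
    have "((\<lambda>t. T t k) \<longlongrightarrow> k) (infty_in J)"
      using eventually_in_time by (intro tendsto_eventually, eventually_elim) (rule k(3))
    then show ?thesis using uniq[OF c] by (simp add: P)
  qed
  have "strongly_converges J T P"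
    by (simp add: strongly_converges_def P c)
  moreover have "rank1_projection P"
  proof -
    have "P (P f) = P f" for f
      by (simp add: P[of f] blinfun.scaleR_right Pk)
    then have "P o\<^sub>L P = P" by (intro blinfun_eqI) simp
    moreover have "range P = span {k}"
    proof -
      have "a *\<^sub>R k = P (a *\<^sub>R k)" for a by (simp add: blinfun.scaleR_right Pk)
      then have "span {k} \<subseteq> range P" unfolding span_singleton by blast
      moreover have "range P \<subseteq> span {k}" unfolding span_singleton by (auto simp: P)
      ultimately show ?thesis by blast
    qed
    moreover have "dim (span {k}) = 1"
      using dim_eq_card_independent[of "{k}"] k(2) by simp
    ultimately show ?thesis by (simp add: rank1_projection_def)
  qed
  moreover have "0 < \<psi> k"
    using k strict by (simp add: lower_bound_iff strictly_positive_def)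
  moreover have "dual_le (\<psi> k *\<^sub>R \<psi>) (dual_op P \<psi>)"
    unfolding dual_le_def
  proof (intro allI impI)
    fix f :: 'a assume "0 \<le> f"
    from lower_bound_asymp_ge[OF k(1) this, unfolded asymp_ge_def]
    have "((\<lambda>t. \<psi> (T t f) + \<psi> (neg_part (T t f - \<psi> f *\<^sub>R k))) \<longlongrightarrow> \<psi> (P f) + 0) (infty_in J)"
      using c[of f] unfolding P by (intro tendsto_intros)
    moreover have "\<psi> f * \<psi> k \<le> \<psi> (T t f) + \<psi> (neg_part (T t f - \<psi> f *\<^sub>R k))" for t
      using \<psi>_mono[OF minus_le_neg_part[of "T t f - \<psi> f *\<^sub>R k"]]
      by (simp add: blinfun.diff_right blinfun.scaleR_right)
    ultimately have "\<psi> f * \<psi> k \<le> \<psi> (P f) + 0"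
      by (intro tendsto_lowerbound[OF _ _ infty_in_neq_bot]) auto
    then show "(\<psi> k *\<^sub>R \<psi>) f \<le> dual_op P \<psi> f"
      by (simp add: dual_op_def blinfun.scaleR_left mult.commute)
  qed
  ultimately show ?thesis using that by blast
qed

text \<open>The range of \<open>P\<close> is spanned by one positive vector \<open>p\<close>, and \<open>P' \<psi> \<ge> \<epsilon> \<psi>\<close> bounds the coefficient of
  \<open>P f\<close> below by \<open>\<epsilon> * \<psi> f / \<psi> p\<close>. So \<open>(\<epsilon> / \<psi> p) *\<^sub>R p\<close> is below every limit \<open>P f\<close> with \<open>\<psi> f = 1\<close>.\<close>

lemma lower_bound_of_rank1_limit:
  assumes "strongly_converges J T P" "rank1_projection P"
    and "0 < \<epsilon>" "dual_le (\<epsilon> *\<^sub>R \<psi>) (dual_op P \<psi>)"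
  obtains h where "h \<noteq> 0" "lower_bound J T \<psi> h"
proof -
  have lim: "((\<lambda>t. T t f) \<longlongrightarrow> P f) (infty_in J)" for f
    using assms(1) by (simp add: strongly_converges_def)
  have P_nonneg: "0 \<le> P f" if "0 \<le> f" for f
    by (rule nonneg_tendsto[OF lim _ infty_in_neq_bot])
      (use eventually_in_time that in \<open>auto elim!: eventually_mono intro: T_nonneg\<close>)
  have P_ge: "\<epsilon> * \<psi> f \<le> \<psi> (P f)" if "0 \<le> f" for f
    using assms(4) that by (simp add: dual_le_def dual_op_def blinfun.scaleR_left)
  have dim: "dim (range P) = 1" using assms(2) by (simp add: rank1_projection_def)
  obtain v where v: "v \<in> range P" "v \<noteq> 0" "range P \<subseteq> span {v}"
  proof -
    obtain V where V: "V \<subseteq> range P" "independent V" "range P \<subseteq> span V" "card V = dim (range P)"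
      by (rule basis_exists)
    then obtain v where Vv: "V = {v}" using dim by (metis card_1_singletonE)
    then show thesis using that[of v] V(1-3) dependent_zero[of V] by auto
  qed
  then obtain x where "P x \<noteq> 0" by blast
  then have "x \<noteq> 0" by auto
  let ?p = "P \<bar>x\<bar>"
  have "0 < \<psi> \<bar>x\<bar>"
    using strict \<open>x \<noteq> 0\<close> by (simp add: strictly_positive_def)
  then have \<psi>p: "0 < \<psi> ?p" using P_ge[of "\<bar>x\<bar>"] assms(3) by (auto intro: less_le_trans[OF mult_pos_pos])
  then have "?p \<noteq> 0" by (metis blinfun.zero_right less_irrefl)
  moreover have "0 \<le> ?p" by (rule P_nonneg) simp
  ultimately have p: "?p \<noteq> 0" "0 \<le> ?p" by simp_all
  have multiple: "\<exists>a. P f = a *\<^sub>R ?p" for f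
  proof -
    obtain a b where ab: "P f = a *\<^sub>R v" "?p = b *\<^sub>R v"
      using v(3) unfolding span_singleton by blast
    then have "b \<noteq> 0" using p(1) by auto
    then have "P f = (a / b) *\<^sub>R ?p" by (simp add: ab)
    then show ?thesis by blast
  qed
  define h where "h = (\<epsilon> / \<psi> ?p) *\<^sub>R ?p"
  have "h \<noteq> 0" using assms(3) \<psi>p p by (simp add: h_def)
  moreover have "0 \<le> h" using assms(3) \<psi>p p(2) by (simp add: h_def scaleR_nonneg_nonneg)
  moreover have "asymp_ge f h" if f: "0 \<le> f" "\<psi> f = 1" for f
  proof -
    obtain a where a: "P f = a *\<^sub>R ?p" using multiple by blast
    have "\<epsilon> \<le> a * \<psi> ?p" using P_ge[OF f(1)] f(2) by (simp add: a blinfun.scaleR_right)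
    then have "\<epsilon> / \<psi> ?p \<le> a" using \<psi>p by (simp add: pos_divide_le_eq)
    then have "h \<le> P f" unfolding h_def a using p(2) by (rule scaleR_right_mono)
    moreover have "asymp_ge f (P f)"
    proof -
      have "((\<lambda>t. norm (T t f - P f)) \<longlongrightarrow> 0) (infty_in J)"
        using lim by (simp add: LIM_zero tendsto_norm_zero)
      then have "((\<lambda>t. neg_part (T t f - P f)) \<longlongrightarrow> 0) (infty_in J)"
        by (rule Lim_null_comparison[OF always_eventually[OF allI[OF norm_neg_part_le]]])
      then have "((\<lambda>t. \<psi> (neg_part (T t f - P f))) \<longlongrightarrow> \<psi> 0) (infty_in J)"
        by (intro tendsto_intros)
      then show ?thesis by (simp add: asymp_ge_def)
    qed
    ultimately show ?thesis using asymp_ge_mono by blast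
  qed
  ultimately show ?thesis using that by (simp add: lower_bound_iff)
qed

end

theorem theorem6p3:
  fixes T :: "real \<Rightarrow> 'a::banach_lattice \<Rightarrow>\<^sub>L 'a"
    and J :: "real set"
    and f\<^sub>0 :: 'a
    and \<psi> :: "'a \<Rightarrow>\<^sub>L real"
    and M :: real
  assumes "order_continuous_norm TYPE('a)"
    and "J = real ` {1..} \<or> J = {0<..}"
    and "op_semigroup J T"
    and "bounded_family J T"
    and "positive_family J T"
    and "M > 0"
    and "quasi_interior_point f\<^sub>0"
    and "dual_le 0 \<psi>"
    and "strictly_positive \<psi>"
    and "\<And>t. t \<in> J \<Longrightarrow> T t f\<^sub>0 \<le> M *\<^sub>R f\<^sub>0"
    and "\<And>t. t \<in> J \<Longrightarrow> dual_le (dual_op (T t) \<psi>) (M *\<^sub>R \<psi>)"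
  shows "(\<exists>P. strongly_converges J T P \<and> rank1_projection P \<and>
            (\<exists>\<epsilon>>0. dual_le (\<epsilon> *\<^sub>R \<psi>) (dual_op P \<psi>)))
     \<longleftrightarrow> (\<exists>h. h \<noteq> 0 \<and> lower_bound J T \<psi> h)"
proof -
  interpret dominated_semigroup T J f\<^sub>0 \<psi> M
    using assms by unfold_locales
  show ?thesis
  proof
    assume "\<exists>P. strongly_converges J T P \<and> rank1_projection P \<and>
      (\<exists>\<epsilon>>0. dual_le (\<epsilon> *\<^sub>R \<psi>) (dual_op P \<psi>))"
    then show "\<exists>h. h \<noteq> 0 \<and> lower_bound J T \<psi> h"
      using lower_bound_of_rank1_limit by metis
  next
    assume "\<exists>h. h \<noteq> 0 \<and> lower_bound J T \<psi> h"
    then obtain h where "h \<noteq> 0" "lower_bound J T \<psi> h" by blast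
    then obtain k where "lower_bound J T \<psi> k" "k \<noteq> 0" "\<And>t. t \<in> J \<Longrightarrow> T t k = k"
      using fixed_lower_bound by blast
    then show "\<exists>P. strongly_converges J T P \<and> rank1_projection P \<and>
      (\<exists>\<epsilon>>0. dual_le (\<epsilon> *\<^sub>R \<psi>) (dual_op P \<psi>))"
      using rank1_limit_of_fixed_lower_bound by metis
  qed
qed

end
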